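(* For every integer $k>1$, \[\sum_{n=1}^{\infty}\frac{(-1)^{n+1}}{T_k(n)} = \frac{k}{k-1}\left(2\sum_{n=1}^{\infty}\frac{(-1)^{n+1}}{T_{k-1}(n)} - 1 \right).\]
   Context: The generalized (higher-order) triangular numbers are defined by $T_0(n)=1$ for all positive integers $n$, and for each positive integer $k$, $T_k(n)=\sum_{i=1}^{n} T_{k-1}(i)$. Thus $T_1(n)=n$, $T_2(n)=n(n+1)/2$, and in general $T_k(n)=\frac{n(n+1)\cdots(n+k-1)}{k!}$. *)

theory Defs
  imports Complex_Main
begin

(* Only arguments n \<ge> 1 are meaningful; the value at n = 0 is never used. *)
primrec gen_triangular :: "nat \<Rightarrow> nat \<Rightarrow> nat" where
  "gen_triangular 0 n = 1"
| "gen_triangular (Suc k) n = (\<Sum>i=1..n. gen_triangular k i)"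

(* The series over n = 1, 2, ... is indexed from 0, so this is the summand at n + 1. *)
definition alt_recip_term :: "nat \<Rightarrow> nat \<Rightarrow> real" where
  "alt_recip_term k n = (-1) ^ ((n + 1) + 1) / real (gen_triangular k (n + 1))"

end

theory Submission
  imports Defs
begin

text \<open>
  Since \<open>T\<^sub>k(n) = (n + k - 1 choose k)\<close>, one has
  \<open>1/T\<^sub>m(n) - 1/T\<^sub>m(n+1) = m/(m+1) \<cdot> 1/T\<^sub>m\<^sub>+\<^sub>1(n)\<close>. Hence adding two consecutive terms of the
  alternating series for \<open>T\<^sub>m\<close> gives \<open>m/(m+1)\<close> times a term of the series for \<open>T\<^sub>m\<^sub>+\<^sub>1\<close>, and summing
  over \<open>n\<close> counts every term of the former twice, except the first one, which is \<open>1\<close>.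
\<close>

text \<open>Pascal's rule matches the recursion of the partial sums, by induction on
  \<open>n\<close> inside the one on \<open>k\<close>. The argument \<open>Suc n\<close> avoids the
  truncated subtraction in \<open>n + k - 1\<close>.\<close>

lemma gen_triangular_Suc_eq_binomial: "gen_triangular k (Suc n) = (n + k) choose k"
proof (induction k arbitrary: n)
  case 0
  show ?case by simp
next
  case (Suc k)
  have "gen_triangular (Suc k) (Suc n) = (n + Suc k) choose Suc k" for n
  proof (induction n)
    case 0
    show ?case using Suc.IH[of 0] by simp
  next
    case (Suc n)
    have "gen_triangular (Suc k) (Suc (Suc n)) =
        gen_triangular (Suc k) (Suc n) + gen_triangular k (Suc (Suc n))"
      by simp
    then show ?case
      by (simp only: Suc.IH \<open>\<And>n. gen_triangular k (Suc n) = (n + k) choose k\<close>) simp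
  qed
  then show ?case .
qed

lemma alt_recip_term_eq_binomial: "alt_recip_term k n = (-1) ^ n / real ((n + k) choose k)"
  by (simp add: alt_recip_term_def gen_triangular_Suc_eq_binomial del: gen_triangular.simps)

lemma inverse_binomial_diff:
  "1 / real ((n + m) choose m) - 1 / real ((Suc n + m) choose m) =
    real m / real (Suc m) * (1 / real ((n + Suc m) choose Suc m))"
proof -
  define a where "a = real ((n + m) choose m)"
  have a: "a > 0"
    by (simp add: a_def)
  \<comment> \<open>Absorption raises the lower index, so it is applied to
    \<open>(n + m) choose n\<close> and carried over by symmetry. Both other binomials thus become
    rational multiples of \<open>a\<close>.\<close>
  have "Suc n * ((Suc n + m) choose m) = Suc (n + m) * ((n + m) choose m)"
    using Suc_times_binomial_eq[of "n + m" n] binomial_symmetric[of n "n + m"]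
      binomial_symmetric[of "Suc n" "Suc n + m"] by (simp add: mult.commute)
  then have b: "real ((Suc n + m) choose m) = real (Suc (n + m)) * a / real (Suc n)"
    unfolding a_def by (metis nonzero_mult_div_cancel_left of_nat_0_neq of_nat_mult)
  have "Suc m * ((n + Suc m) choose Suc m) = Suc (n + m) * ((n + m) choose m)"
    using Suc_times_binomial_eq[of "n + m" m] by (simp add: mult.commute)
  then have c: "real ((n + Suc m) choose Suc m) = real (Suc (n + m)) * a / real (Suc m)"
    unfolding a_def by (metis nonzero_mult_div_cancel_left of_nat_0_neq of_nat_mult)
  have "1 / a - 1 / (real (Suc (n + m)) * a / real (Suc n)) =
      (real (Suc (n + m)) - real (Suc n)) / (real (Suc (n + m)) * a)"
    using a by (simp add: diff_divide_distrib del: of_nat_Suc)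
  \<comment> \<open>The numerator is \<open>m\<close>, and the factor \<open>Suc m\<close>
    cancels.\<close>
  also have "\<dots> = real m / real (Suc m) * (1 / (real (Suc (n + m)) * a / real (Suc m)))"
    by simp
  finally show ?thesis
    unfolding b c a_def[symmetric] .
qed

lemma alt_recip_term_add_Suc:
  "alt_recip_term m n + alt_recip_term m (Suc n) =
    real m / real (Suc m) * alt_recip_term (Suc m) n"
proof -
  have "alt_recip_term m n + alt_recip_term m (Suc n) =
      (-1) ^ n * (1 / real ((n + m) choose m) - 1 / real ((Suc n + m) choose m))"
    by (simp add: alt_recip_term_eq_binomial right_diff_distrib)
  also have "\<dots> = real m / real (Suc m) * alt_recip_term (Suc m) n"
    unfolding inverse_binomial_diff alt_recip_term_eq_binomial by simp
  finally show ?thesis .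
qed

text \<open>Stated with \<open>sums\<close> so that it yields the value and also passes convergence
  from \<open>m\<close> to \<open>Suc m\<close>.\<close>

lemma alt_recip_term_Suc_sums:
  assumes "m > 0" and "summable (alt_recip_term m)"
  shows "alt_recip_term (Suc m) sums
    (real (Suc m) / real m * (2 * (\<Sum>n. alt_recip_term m n) - 1))"
proof -
  let ?S = "\<Sum>n. alt_recip_term m n"
  have "alt_recip_term m sums ?S"
    using assms(2) by (rule summable_sums)
  \<comment> \<open>The dropped term, at index 0, is 1.\<close>
  moreover from this have "(\<lambda>n. alt_recip_term m (Suc n)) sums (?S - 1)"
    by (subst sums_Suc_iff) (simp add: alt_recip_term_eq_binomial[of m 0])
  ultimately have "(\<lambda>n. alt_recip_term m n + alt_recip_term m (Suc n)) sums (?S + (?S - 1))"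
    by (rule sums_add)
  then have "(\<lambda>n. real (Suc m) / real m * (real m / real (Suc m) * alt_recip_term (Suc m) n))
      sums (real (Suc m) / real m * (?S + (?S - 1)))"
    unfolding alt_recip_term_add_Suc by (rule sums_mult)
  then show ?thesis
    using assms(1) by (simp add: algebra_simps del: of_nat_Suc)
qed

lemma summable_alt_recip_term: "m > 0 \<Longrightarrow> summable (alt_recip_term m)"
proof (induction m rule: nat_induct_non_zero)
  \<comment> \<open>This is the alternating harmonic series, the only place where a convergence test
    is required.\<close>
  case 1
  have "summable (\<lambda>n. (-1) ^ n * (1 / real (Suc n)))"
    by (rule summable_Leibniz(1)) (use LIMSEQ_inverse_real_of_nat in
      \<open>auto simp: monoseq_Suc field_simps\<close>)
  then show ?case
    by (simp add: alt_recip_term_eq_binomial[abs_def])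
next
  case (Suc m)
  then show ?case
    using alt_recip_term_Suc_sums sums_summable by blast
qed

theorem theorem2p3:
  fixes k :: nat
  assumes "k > 1"
  shows "summable (alt_recip_term k) \<and> summable (alt_recip_term (k - 1)) \<and>
    (\<Sum>n. alt_recip_term k n) =
      real k / (real k - 1) * (2 * (\<Sum>n. alt_recip_term (k - 1) n) - 1)"
proof -
  obtain m where k: "k = Suc m" and "m > 0"
    using assms by (cases k) auto
  then show ?thesis
    using alt_recip_term_Suc_sums[of m] summable_alt_recip_term[of m]
    by (auto simp: sums_iff)
qed

end
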